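(* Let $M$ be a finite abelian group. Then $\Sigma_M=\emptyset$ if and only if $M\simeq(\mathbb Z/2\mathbb Z)^l$ or $M\simeq(\mathbb Z/3\mathbb Z)^l$ for some $l\ge0$.
   Context: For integers $0\le\alpha<N$, $r>0$, let $M_{r,\alpha,N}=\mathbb Z^2/\langle(r,-\alpha),(0,N)\rangle$. For $q\in\mathbb Z$ let $d_q$ be the unique integer with $0<d_q\le N$ and $d_q\equiv-q\alpha\bmod N$, and put $$\Omega_{N-\alpha,N}=\{0<q\le N/(\alpha,N)\mid d_{q'}<d_q\text{ for every }0<q'<q\},$$ where $(\alpha,N)$ denotes the greatest common divisor. $\Sigma_M$ is the set of sequences $(r,\alpha,N,\overline q,\phi)$ with $r,\alpha,N$ integers such that $0\le\alpha<N$, $r>0$, $N>1$ and ($r>1$ or $\alpha>1$); $\overline q\in\Omega_{N-\alpha,N}$ such that $\overline qr\ne1$, $\overline q\alpha\not\equiv1\bmod N$ and $\overline q\ne N/(\alpha,N)$; and $\phi\colon M\to M_{r,\alpha,N}$ a surjective homomorphism. *)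

theory Defs
  imports "HOL-Algebra.Product_Groups" "HOL-Number_Theory.Cong"
begin

abbreviation int_sq_group :: "(int \<times> int) monoid" where
  "int_sq_group \<equiv> integer_group \<times>\<times> integer_group"

definition M_group :: "int \<Rightarrow> int \<Rightarrow> int \<Rightarrow> (int \<times> int) set monoid" where
  "M_group r \<alpha> N = int_sq_group Mod generate int_sq_group {(r, - \<alpha>), (0, N)}"

definition d_val :: "int \<Rightarrow> int \<Rightarrow> int \<Rightarrow> int" where
  "d_val \<alpha> N q = (THE d. 0 < d \<and> d \<le> N \<and> [d = - q * \<alpha>] (mod N))"

lemma d_val_unique:
  assumes "N > 0"
  shows "\<exists>!d. 0 < d \<and> d \<le> N \<and> [d = - q * \<alpha>] (mod (N::int))"
proof (rule ex1I[of _ "N - (q * \<alpha>) mod N"])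
  show "0 < N - (q * \<alpha>) mod N \<and> N - (q * \<alpha>) mod N \<le> N \<and>
      [N - (q * \<alpha>) mod N = - q * \<alpha>] (mod N)"
    using assms by (simp add: cong_def mod_minus_eq)
next
  fix d assume d: "0 < d \<and> d \<le> N \<and> [d = - q * \<alpha>] (mod N)"
  have "[d = N - (q * \<alpha>) mod N] (mod N)"
    using d by (simp add: cong_def mod_minus_eq)
  then have "N dvd d - (N - (q * \<alpha>) mod N)"
    by (simp add: cong_iff_dvd_diff)
  moreover have "\<bar>d - (N - (q * \<alpha>) mod N)\<bar> < N"
    using d pos_mod_bound[OF assms, of "q * \<alpha>"] pos_mod_sign[OF assms, of "q * \<alpha>"]
    by linarith
  ultimately show "d = N - (q * \<alpha>) mod N"
    using dvd_imp_le_int[of "d - (N - (q * \<alpha>) mod N)" N] assms by fastforce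
qed

(* Omega_set \<alpha> N is the set written Omega_{N - \<alpha>, N} in the source:
   the first argument is \<alpha> itself, not N - \<alpha>. *)
definition Omega_set :: "int \<Rightarrow> int \<Rightarrow> int set" where
  "Omega_set \<alpha> N =
     {q. 0 < q \<and> q \<le> N div gcd \<alpha> N \<and>
         (\<forall>q'. 0 < q' \<and> q' < q \<longrightarrow> d_val \<alpha> N q' < d_val \<alpha> N q)}"

(* Intersecting with extensional fixes the values of \<phi> off the carrier of M, so that
   distinct elements correspond to distinct homomorphisms on the carrier. *)
definition Sigma_set ::
  "('a, 'b) monoid_scheme \<Rightarrow>
     (int \<times> int \<times> int \<times> int \<times> ('a \<Rightarrow> (int \<times> int) set)) set" where
  "Sigma_set M =
     {(r, \<alpha>, N, q, \<phi>).
        0 \<le> \<alpha> \<and> \<alpha> < N \<and> r > 0 \<and> N > 1 \<and> (r > 1 \<or> \<alpha> > 1) \<and>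
        q \<in> Omega_set \<alpha> N \<and>
        q * r \<noteq> 1 \<and> \<not> [q * \<alpha> = 1] (mod N) \<and> q \<noteq> N div gcd \<alpha> N \<and>
        \<phi> \<in> epi M (M_group r \<alpha> N) \<inter> extensional (carrier M)}"

definition cyclic_power :: "nat \<Rightarrow> nat \<Rightarrow> (nat \<Rightarrow> int) monoid" where
  "cyclic_power n l = product_group {..<l} (\<lambda>_. integer_mod_group n)"

end

theory Submission
  imports Defs "HOL-Algebra.Multiplicative_Group"
begin

text \<open>If \<open>M\<close> has an element of order at least \<open>4\<close>, then it has a cyclic quotient of some order
  \<open>N \<ge> 4\<close>, which is isomorphic to \<open>M_group 1 (N - 1) N\<close>. With the index \<open>2\<close> these parameters form an
  element of \<open>\<Sigma>\<^sub>M\<close> (\<open>Sigma_set_nonempty_if_large_cyclic_quotient\<close>). Otherwise all orders are at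
  most \<open>3\<close>; as the orders \<open>2\<close> and \<open>3\<close> together would produce the order \<open>6\<close>, the exponent of
  \<open>M\<close> divides \<open>2\<close> or \<open>3\<close>, and \<open>M\<close> is elementary abelian
  (\<open>iso_cyclic_power_if_prime_exponent\<close>).

  Conversely, suppose that a prime \<open>p\<close> kills \<open>M\<close> and that \<open>M\<close> surjects onto
  \<open>M_group r \<alpha> N\<close>. Then \<open>p\<close> kills this quotient, so \<open>N = p\<close>, and \<open>r = 1\<close> or \<open>\<alpha> = 0\<close>
  (\<open>pow_prime_eq_one_imp_M_group_params\<close>). For \<open>p \<le> 3\<close> the few remaining parameters violate the
  conditions on the index \<open>q\<close> (\<open>Sigma_set_empty_if_exponent_2_or_3\<close>).

  Both the cyclic quotient and the structure of the elementary abelian groups come from one fact: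
  if \<open>a\<^sup>e = \<one>\<close> holds throughout a finite abelian group, then a homomorphism from a subgroup to
  \<open>\<int>/e\<int>\<close> extends to the whole group (\<open>extend_additive_mod_to_carrier\<close>). The divisibility
  needed to choose its value at one more element is \<open>compatible_value_exists\<close>.\<close>

section \<open>Additive functions modulo an integer\<close>

lemma int_subgroup_eq_multiples:
  fixes S :: "int set"
  assumes e: "e \<in> S" "e > 0" and diff: "\<And>u v. u \<in> S \<Longrightarrow> v \<in> S \<Longrightarrow> u - v \<in> S"
  obtains d where "d > 0" "S = {k. d dvd k}"
proof -
  have zero: "0 \<in> S" using diff[OF e(1) e(1)] by simp
  have uminus: "- u \<in> S" if "u \<in> S" for u using diff[OF zero that] by simp
  have plus: "u + v \<in> S" if "u \<in> S" "v \<in> S" for u v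
    using diff[OF that(1) uminus[OF that(2)]] by simp
  have times: "k * u \<in> S" if "u \<in> S" for k u
  proof (induction k rule: int_induct[where k = 0])
    case base show ?case by (simp add: zero)
  next
    case (step1 i) then show ?case using plus[OF that, of "i * u"] by (simp add: algebra_simps)
  next
    case (step2 i) then show ?case using diff[OF _ that] by (simp add: algebra_simps)
  qed
  define n where "n = (LEAST n::nat. n > 0 \<and> int n \<in> S)"
  have "nat e > 0 \<and> int (nat e) \<in> S" using e by simp
  then have n: "n > 0" "int n \<in> S"
    unfolding n_def by (metis (mono_tags, lifting) LeastI)+
  have "int n dvd k" if "k \<in> S" for k
  proof (rule ccontr)
    assume "\<not> int n dvd k"
    then have pos: "k mod int n > 0"
      using n(1) by (simp add: dvd_eq_mod_eq_0 order.not_eq_order_implies_strict)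
    have "k mod int n \<in> S"
      using diff[OF that times[OF n(2), of "k div int n"]] by (simp add: minus_div_mult_eq_mod)
    then have "n \<le> nat (k mod int n)"
      unfolding n_def using pos by (intro Least_le) (simp add: n_def)
    then show False using pos_mod_bound[of "int n" k] n(1) pos by linarith
  qed
  moreover have "k \<in> S" if "int n dvd k" for k
    using that times[OF n(2)] by (auto elim!: dvdE simp: mult.commute)
  ultimately show thesis using that[of "int n"] n(1) by auto
qed

text \<open>Homomorphisms into \<open>\<int>/e\<int>\<close> are represented by arbitrary integer representatives of their
  values. Integers, unlike residues, can be divided by a common divisor, which turns a homomorphism
  with proper image into a surjection onto a smaller cyclic group.\<close>
definition additive_mod :: "('a, 'b) monoid_scheme \<Rightarrow> 'a set \<Rightarrow> int \<Rightarrow> ('a \<Rightarrow> int) \<Rightarrow> bool" where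
  "additive_mod G H e f \<longleftrightarrow> (\<forall>x\<in>H. \<forall>y\<in>H. [f (x \<otimes>\<^bsub>G\<^esub> y) = f x + f y] (mod e))"

lemma additive_modD:
  "additive_mod G H e f \<Longrightarrow> x \<in> H \<Longrightarrow> y \<in> H \<Longrightarrow> [f (x \<otimes>\<^bsub>G\<^esub> y) = f x + f y] (mod e)"
  by (simp add: additive_mod_def)

lemma (in group) additive_mod_one:
  assumes "subgroup H G" "additive_mod G H e f"
  shows "[f \<one> = 0] (mod e)"
  using additive_modD[OF assms(2) subgroup.one_closed[OF assms(1)] subgroup.one_closed[OF assms(1)]]
  by (simp add: cong_iff_dvd_diff)

lemma (in group) additive_mod_int_pow:
  assumes H: "subgroup H G" and f: "additive_mod G H e f" and x: "x \<in> H"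
  shows "[f (x [^] (k::int)) = k * f x] (mod e)"
proof -
  have xc: "x \<in> carrier G" using subgroup.mem_carrier[OF H x] .
  have step: "[f (x [^] (i + 1)) = f (x [^] i) + f x] (mod e)" for i :: int
    using additive_modD[OF f subgroup_int_pow_closed[OF H x, of i] x] xc
    by (simp add: int_pow_mult)
  show ?thesis
  proof (induction k rule: int_induct[where k = 0])
    case base show ?case using additive_mod_one[OF H f] by simp
  next
    case (step1 i)
    have "[f (x [^] i) + f x = i * f x + f x] (mod e)"
      using step1(2) by (rule cong_add) simp
    with step[of i] have "[f (x [^] (i + 1)) = i * f x + f x] (mod e)" by (rule cong_trans)
    then show ?case by (simp add: algebra_simps)
  next
    case (step2 i)
    have "[f (x [^] i) = f (x [^] (i - 1)) + f x] (mod e)" using step[of "i - 1"] by simp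
    then have "[f (x [^] (i - 1)) + f x = i * f x] (mod e)"
      using step2(2) by (metis cong_sym cong_trans)
    then show ?case by (simp add: cong_iff_dvd_diff algebra_simps)
  qed
qed

text \<open>The value \<open>b\<close> at a new element \<open>a\<close> may be prescribed as soon as it agrees with \<open>f\<close> on
  those powers of \<open>a\<close> that already lie in \<open>H\<close>: two representations of an element as \<open>h a\<^sup>k\<close>
  differ exactly by such a power.\<close>
lemma (in comm_group) extend_additive_mod:
  assumes H: "subgroup H G" and f: "additive_mod G H e f" and a: "a \<in> carrier G"
    and compat: "\<And>k::int. a [^] k \<in> H \<Longrightarrow> [f (a [^] k) = k * b] (mod e)"
  obtains g where "additive_mod G (H <#> range (\<lambda>k::int. a [^] k)) e g"
    and "\<And>h k. h \<in> H \<Longrightarrow> [g (h \<otimes> a [^] (k::int)) = f h + k * b] (mod e)"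
proof -
  have Hc: "h \<in> carrier G" if "h \<in> H" for h using subgroup.mem_carrier[OF H that] .
  have Hm: "h \<otimes> h' \<in> H" if "h \<in> H" "h' \<in> H" for h h' using subgroup.m_closed[OF H that] .
  have well_defined: "[f h + k * b = f h' + k' * b] (mod e)"
    if h: "h \<in> H" "h' \<in> H" and eq: "h \<otimes> a [^] k = h' \<otimes> a [^] k'" for h h' and k k' :: int
  proof -
    have d: "a [^] (k - k') = inv h \<otimes> h'"
    proof -
      have "a [^] k = inv h \<otimes> (h' \<otimes> a [^] k')"
        using eq h Hc a by (metis inv_solve_left int_pow_closed m_closed)
      then have "a [^] k \<otimes> inv (a [^] k') = inv h \<otimes> h'"
        using h Hc a by (simp add: m_assoc)
      then show ?thesis using a by (simp add: int_pow_diff)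
    qed
    have mem: "a [^] (k - k') \<in> H"
      unfolding d using h subgroup.m_inv_closed[OF H] Hm by blast
    have "h' = h \<otimes> a [^] (k - k')"
      unfolding d using h Hc by (simp add: m_assoc[symmetric])
    then have "[f h' = f h + f (a [^] (k - k'))] (mod e)"
      using additive_modD[OF f h(1) mem] by simp
    moreover have "[f h + f (a [^] (k - k')) = f h + (k - k') * b] (mod e)"
      using compat[OF mem] by (simp add: cong_add_lcancel)
    ultimately have "[f h' = f h + (k - k') * b] (mod e)" by (rule cong_trans)
    then have "[f h' + k' * b = f h + (k - k') * b + k' * b] (mod e)"
      by (rule cong_add) simp
    then show ?thesis by (simp add: algebra_simps cong_sym)
  qed
  define g where
    "g y = (SOME v. \<exists>h\<in>H. \<exists>k::int. y = h \<otimes> a [^] k \<and> v = f h + k * b)" for y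
  have g: "[g (h \<otimes> a [^] k) = f h + k * b] (mod e)" if "h \<in> H" for h and k :: int
  proof -
    have "\<exists>h'\<in>H. \<exists>k'::int. h \<otimes> a [^] k = h' \<otimes> a [^] k' \<and> g (h \<otimes> a [^] k) = f h' + k' * b"
      unfolding g_def by (rule someI_ex) (use that in blast)
    then obtain h' and k' :: int where "h' \<in> H" "h \<otimes> a [^] k = h' \<otimes> a [^] k'"
      and v: "g (h \<otimes> a [^] k) = f h' + k' * b" by blast
    from well_defined[OF that this(1,2)] show ?thesis unfolding v by (rule cong_sym)
  qed
  have "additive_mod G (H <#> range (\<lambda>k::int. a [^] k)) e g"
    unfolding additive_mod_def
  proof (intro ballI)
    fix x y assume "x \<in> H <#> range (\<lambda>k::int. a [^] k)" "y \<in> H <#> range (\<lambda>k::int. a [^] k)"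
    then obtain h h' and k k' :: int where h: "h \<in> H" "h' \<in> H"
      and x: "x = h \<otimes> a [^] k" and y: "y = h' \<otimes> a [^] k'"
      unfolding set_mult_def by auto
    have xy: "x \<otimes> y = (h \<otimes> h') \<otimes> a [^] (k + k')"
      unfolding x y using h Hc a by (simp add: int_pow_mult m_ac)
    have "[g (x \<otimes> y) = f (h \<otimes> h') + (k + k') * b] (mod e)"
      unfolding xy by (rule g[OF Hm[OF h]])
    also have "[f (h \<otimes> h') + (k + k') * b = (f h + f h') + (k + k') * b] (mod e)"
      by (rule cong_add[OF additive_modD[OF f h]]) simp
    also have "(f h + f h') + (k + k') * b = (f h + k * b) + (f h' + k' * b)"
      by (simp add: algebra_simps)
    also have "[(f h + k * b) + (f h' + k' * b) = g x + g y] (mod e)"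
      unfolding x y by (intro cong_add cong_sym[OF g] h)
    finally show "[g (x \<otimes> y) = g x + g y] (mod e)" .
  qed
  with g show thesis using that by blast
qed

text \<open>The powers of \<open>a\<close> that lie in \<open>H\<close> are the powers of \<open>a\<^sup>n\<close> for some \<open>n\<close>, so the only
  condition on \<open>b\<close> is \<open>n b \<equiv> f (a\<^sup>n)\<close> modulo \<open>e\<close>. It is solvable because \<open>a\<^sup>e = \<one>\<close>: writing
  \<open>e = n m\<close> gives \<open>m f (a\<^sup>n) \<equiv> f \<one> \<equiv> 0\<close> modulo \<open>n m\<close>, and hence \<open>n\<close> divides \<open>f (a\<^sup>n)\<close>.\<close>
lemma (in comm_group) compatible_value_exists:
  assumes H: "subgroup H G" and f: "additive_mod G H (int e) f" and a: "a \<in> carrier G"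
    and e: "e > 0" "a [^] e = \<one>"
  obtains b where "\<And>k::int. a [^] k \<in> H \<Longrightarrow> [f (a [^] k) = k * b] (mod int e)"
proof -
  define S where "S = {k::int. a [^] k \<in> H}"
  have ae: "a [^] int e = \<one>" using e by (simp add: int_pow_int)
  have eS: "int e \<in> S" unfolding S_def using ae subgroup.one_closed[OF H] by simp
  have diff: "u - v \<in> S" if "u \<in> S" "v \<in> S" for u v
    using that subgroup.m_closed[OF H] subgroup.m_inv_closed[OF H] a
    by (simp add: S_def int_pow_diff)
  have "int e > 0" using e(1) by simp
  from eS this diff obtain n where n: "n > 0" "S = {k. n dvd k}"
    by (rule int_subgroup_eq_multiples)
  have S_iff: "a [^] k \<in> H \<longleftrightarrow> n dvd k" for k
    using n(2) unfolding S_def by (simp only: set_eq_iff mem_Collect_eq)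
  have an: "a [^] n \<in> H" by (simp add: S_iff)
  have pow: "[f (a [^] (n * t)) = t * f (a [^] n)] (mod int e)" for t
    using additive_mod_int_pow[OF H f an, of t] a by (simp add: int_pow_pow)
  have "n dvd int e" using eS n(2) by simp
  then obtain m where m: "int e = n * m" ..
  have "m \<noteq> 0" using m e(1) by auto
  have "[m * f (a [^] n) = 0] (mod int e)"
    using pow[of m] additive_mod_one[OF H f] ae m by (metis cong_sym cong_trans)
  then have "n * m dvd f (a [^] n) * m" by (simp add: cong_0_iff m mult.commute)
  then have "n dvd f (a [^] n)" using \<open>m \<noteq> 0\<close> by simp
  then obtain b where b: "f (a [^] n) = n * b" ..
  have "[f (a [^] k) = k * b] (mod int e)" if "a [^] k \<in> H" for k
  proof -
    have "n dvd k" using that by (simp add: S_iff)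
    then obtain t where "k = n * t" ..
    then show ?thesis using pow[of t] b by (simp add: ac_simps)
  qed
  then show thesis using that by blast
qed

text \<open>Extending to one more element at a time exhausts the finite group. The values are
  only preserved modulo \<open>e\<close>, since each step chooses new representatives.\<close>
lemma (in comm_group) extend_additive_mod_to_carrier:
  assumes fin: "finite (carrier G)" and e: "e > 0" "\<And>x. x \<in> carrier G \<Longrightarrow> x [^] e = \<one>"
    and H: "subgroup H G" and f: "additive_mod G H (int e) f"
  shows "\<exists>g. additive_mod G (carrier G) (int e) g \<and> (\<forall>h\<in>H. [g h = f h] (mod int e))"
  using H f
proof (induction "card (carrier G - H)" arbitrary: H f rule: less_induct)
  case less
  show ?case
  proof (cases "H = carrier G")
    case True then show ?thesis using less.prems by auto
  next
    case False
    note sub = subgroup.subset[OF less.prems(1)]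
    from False sub obtain a where a: "a \<in> carrier G" "a \<notin> H" by blast
    obtain b where b: "\<And>k::int. a [^] k \<in> H \<Longrightarrow> [f (a [^] k) = k * b] (mod int e)"
      using compatible_value_exists[OF less.prems a(1) e(1) e(2)[OF a(1)]] by blast
    let ?K = "H <#> range (\<lambda>k::int. a [^] k)"
    obtain g where g: "additive_mod G ?K (int e) g"
      and gf: "\<And>h k. h \<in> H \<Longrightarrow> [g (h \<otimes> a [^] (k::int)) = f h + k * b] (mod int e)"
      using extend_additive_mod[OF less.prems a(1) b] by blast
    have K: "subgroup ?K G" using mult_subgroups[OF less.prems(1) subgroup_of_powers[OF a(1)]] .
    have HK: "H \<subseteq> ?K"
    proof
      fix h assume h: "h \<in> H"
      have "h \<otimes> a [^] (0::int) \<in> ?K" unfolding set_mult_def using h by blast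
      then show "h \<in> ?K" using h sub by auto
    qed
    have "\<one> \<otimes> a [^] (1::int) \<in> ?K"
      unfolding set_mult_def using subgroup.one_closed[OF less.prems(1)] by blast
    then have "a \<in> ?K" using a by simp
    with HK a have "carrier G - ?K \<subset> carrier G - H" by blast
    then have "card (carrier G - ?K) < card (carrier G - H)"
      using fin by (simp add: psubset_card_mono)
    from less.hyps[OF this K g] obtain g' where g': "additive_mod G (carrier G) (int e) g'"
      "\<forall>h\<in>?K. [g' h = g h] (mod int e)" by blast
    have "[g' h = f h] (mod int e)" if h: "h \<in> H" for h
    proof -
      have "[g h = f h] (mod int e)" using gf[OF h, of 0] h sub by auto
      then show ?thesis using g'(2) HK h by (meson cong_trans subsetD)
    qed
    with g'(1) show ?thesis by blast
  qed
qed

text \<open>On the subgroup generated by \<open>a\<close> the function \<open>a\<^sup>k \<mapsto> k e / ord a\<close> is well defined modulo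
  \<open>e\<close>; extending it to the whole group shows that homomorphisms to \<open>\<int>/e\<int>\<close> detect the order of
  every element.\<close>
lemma (in comm_group) additive_mod_of_order_exists:
  assumes fin: "finite (carrier G)" and e: "e > 0" "\<And>x. x \<in> carrier G \<Longrightarrow> x [^] e = \<one>"
    and a: "a \<in> carrier G"
  obtains f where "additive_mod G (carrier G) (int e) f" "[f a = int (e div ord a)] (mod int e)"
proof -
  have "ord a dvd e" using e(2)[OF a] a by (simp add: pow_eq_id)
  then have de: "e = ord a * (e div ord a)" by (rule dvd_mult_div_cancel[symmetric])
  have one: "subgroup {\<one>} G" by (rule triv_subgroup)
  have zero: "additive_mod G {\<one>} (int e) (\<lambda>_. 0)" by (simp add: additive_mod_def)
  have "[0 = k * int (e div ord a)] (mod int e)" if "a [^] k \<in> {\<one>}" for k :: int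
  proof -
    have "int (ord a) dvd k" using that a int_pow_eq_id by simp
    then have "int (ord a) * int (e div ord a) dvd k * int (e div ord a)" by simp
    then have "int e dvd k * int (e div ord a)" using de by (metis of_nat_mult)
    then show ?thesis by (simp add: cong_0_iff cong_sym_eq[of 0])
  qed
  then obtain g where g: "additive_mod G ({\<one>} <#> range (\<lambda>k::int. a [^] k)) (int e) g"
    and ga: "\<And>h k. h \<in> {\<one>} \<Longrightarrow> [g (h \<otimes> a [^] (k::int)) = 0 + k * int (e div ord a)] (mod int e)"
    using extend_additive_mod[OF one zero a, of "int (e div ord a)"] by blast
  have "\<one> \<otimes> a [^] (1::int) \<in> {\<one>} <#> range (\<lambda>k::int. a [^] k)"
    unfolding set_mult_def by blast
  then have mem: "a \<in> {\<one>} <#> range (\<lambda>k::int. a [^] k)" using a by simp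
  have "[g a = int (e div ord a)] (mod int e)" using ga[of \<one> 1] a by simp
  with extend_additive_mod_to_carrier[OF fin e mult_subgroups[OF one subgroup_of_powers[OF a]] g]
    mem that show thesis by (meson cong_trans)
qed

section \<open>Cyclic quotients\<close>

text \<open>The additive function \<open>f\<close> of the previous lemma, taken modulo the group order \<open>e\<close>, need
  not be onto. Its values modulo \<open>e\<close> form a subgroup \<open>d\<int>\<close> of the integers that contains \<open>e\<close>, so
  \<open>f / d\<close> is onto modulo \<open>N = e / d\<close>. As \<open>d\<close> divides the value \<open>e / ord a\<close>, the order of \<open>a\<close>
  divides \<open>N\<close>.\<close>
lemma (in comm_group) cyclic_quotient_of_order_multiple:
  assumes fin: "finite (carrier G)" and a: "a \<in> carrier G"
  obtains N f where "N > 0" "int (ord a) dvd N" "additive_mod G (carrier G) N f"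
    "\<And>k. \<exists>x\<in>carrier G. [f x = k] (mod N)"
proof -
  define e where "e = order G"
  have e: "e > 0" "\<And>x. x \<in> carrier G \<Longrightarrow> x [^] e = \<one>"
    using fin pow_order_eq_1 order_gt_0_iff_finite by (auto simp: e_def)
  obtain f where f: "additive_mod G (carrier G) (int e) f" "[f a = int (e div ord a)] (mod int e)"
    using additive_mod_of_order_exists[OF fin e a] by blast
  define S where "S = {v. \<exists>x\<in>carrier G. [v = f x] (mod int e)}"
  have f1: "[f \<one> = 0] (mod int e)" using additive_mod_one[OF subgroup_self f(1)] .
  have eS: "int e \<in> S"
    unfolding S_def using f1 by (auto intro!: bexI[of _ \<one>] simp: cong_def)
  have diff: "u - v \<in> S" if uv: "u \<in> S" "v \<in> S" for u v
  proof -
    obtain x y where xy: "x \<in> carrier G" "y \<in> carrier G"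
      and u: "[u = f x] (mod int e)" and v: "[v = f y] (mod int e)"
      using uv unfolding S_def by blast
    have "[f x = f (x \<otimes> inv y) + f y] (mod int e)"
      using additive_modD[OF f(1), of "x \<otimes> inv y" y] xy by (simp add: m_assoc)
    then have "[f x - f y = f (x \<otimes> inv y) + f y - f y] (mod int e)"
      by (rule cong_diff) simp
    then have "[u - v = f (x \<otimes> inv y)] (mod int e)"
      using cong_diff[OF u v] by (simp add: cong_def)
    then show ?thesis unfolding S_def using xy by blast
  qed
  have "int e > 0" using e(1) by simp
  from eS this diff obtain d where d: "d > 0" "S = {k. d dvd k}"
    by (rule int_subgroup_eq_multiples)
  have "d dvd int e" using eS d(2) by simp
  then obtain N where N: "int e = d * N" ..
  have "d * N > 0" using N e(1) by linarith
  then have Npos: "N > 0" using d(1) by (simp add: zero_less_mult_iff)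
  have "int (e div ord a) \<in> S" unfolding S_def using f(2) a cong_sym by blast
  then have "d dvd int (e div ord a)" using d(2) by simp
  then obtain t where t: "int (e div ord a) = d * t" ..
  have "ord a dvd e" using e(2)[OF a] a by (simp add: pow_eq_id)
  then have "int e = int (ord a) * int (e div ord a)" by (metis dvd_mult_div_cancel of_nat_mult)
  then have "d * N = d * (int (ord a) * t)" using N t by (simp add: ac_simps)
  then have dvdN: "int (ord a) dvd N" using d(1) by simp
  have fd: "f x = d * (f x div d)" if "x \<in> carrier G" for x
  proof -
    have "f x \<in> S" unfolding S_def using that cong_refl by blast
    then show ?thesis using d(2) by simp
  qed
  have cancel: "[u = v] (mod N)" if "[d * u = d * v] (mod int e)" for u v
  proof -
    have "d * N dvd d * (u - v)" using that by (simp add: cong_iff_dvd_diff N algebra_simps)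
    then show ?thesis using d(1) by (simp add: cong_iff_dvd_diff)
  qed
  have "additive_mod G (carrier G) N (\<lambda>x. f x div d)"
    unfolding additive_mod_def
  proof (intro ballI cancel)
    fix x y assume xy: "x \<in> carrier G" "y \<in> carrier G"
    show "[d * (f (x \<otimes> y) div d) = d * (f x div d + f y div d)] (mod int e)"
      using additive_modD[OF f(1) xy] fd[OF xy(1)] fd[OF xy(2)] fd[OF m_closed[OF xy]]
      by (simp add: distrib_left)
  qed
  moreover have "\<exists>x\<in>carrier G. [f x div d = k] (mod N)" for k
  proof -
    have "d * k \<in> S" using d(2) by simp
    then obtain x where x: "x \<in> carrier G" "[d * k = f x] (mod int e)" unfolding S_def by blast
    then have "[d * (f x div d) = d * k] (mod int e)" using fd[OF x(1)] by (simp add: cong_sym_eq)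
    then show ?thesis using cancel x(1) by blast
  qed
  ultimately show thesis using that Npos dvdN by blast
qed

section \<open>Elementary abelian groups\<close>

lemma carrier_cyclic_power:
  "n > 0 \<Longrightarrow> carrier (cyclic_power n l) = {..<l} \<rightarrow>\<^sub>E {0..<int n}"
  by (simp add: cyclic_power_def carrier_integer_mod_group cong: PiE_cong)

lemma mult_cyclic_power:
  "x \<otimes>\<^bsub>cyclic_power n l\<^esub> y = (\<lambda>i\<in>{..<l}. (x i + y i) mod int n)"
  by (simp add: cyclic_power_def)

lemma group_cyclic_power: "group (cyclic_power n l)"
  by (simp add: cyclic_power_def)

lemma pow_cyclic_power_eq_one:
  assumes "n > 0"
  shows "x [^]\<^bsub>cyclic_power n l\<^esub> n = \<one>\<^bsub>cyclic_power n l\<^esub>"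
proof -
  have "x [^]\<^bsub>cyclic_power n l\<^esub> k = (\<lambda>i\<in>{..<l}. (int k * x i) mod int n)" for k :: nat
  proof (induction k)
    case 0 then show ?case by (simp add: cyclic_power_def)
  next
    case (Suc k)
    then show ?case
      by (auto simp: mult_cyclic_power mod_add_right_eq algebra_simps fun_eq_iff)
  qed
  then show ?thesis by (auto simp: cyclic_power_def)
qed

text \<open>Take a surjection \<open>\<Phi>\<close> onto a power of \<open>\<int>/p\<int>\<close> with as many factors as possible. If
  \<open>x \<noteq> \<one>\<close> were in its kernel, an additive function \<open>f\<close> with \<open>f x = 1\<close> could be added as one
  more coordinate: multiplying by a power of \<open>x\<close> changes \<open>f\<close> arbitrarily without changing
  \<open>\<Phi>\<close>, so the longer map is still onto. Hence \<open>\<Phi>\<close> is an isomorphism.\<close>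
lemma (in comm_group) iso_cyclic_power_if_prime_exponent:
  assumes fin: "finite (carrier G)" and p: "prime p"
    and expo: "\<And>x. x \<in> carrier G \<Longrightarrow> x [^] p = \<one>"
  shows "\<exists>l. G \<cong> cyclic_power p l"
proof -
  have p1: "p > 1" using p prime_gt_1_nat by blast
  then have p0: "p > 0" by simp
  let ?P = "\<lambda>l. \<exists>\<Phi>. \<Phi> \<in> epi G (cyclic_power p l)"
  have base: "?P 0"
  proof
    show "(\<lambda>_ _. undefined) \<in> epi G (cyclic_power p 0)"
      using p0 one_closed
      by (auto simp: epi_def hom_def carrier_cyclic_power mult_cyclic_power restrict_def)
  qed
  have bound: "l \<le> card (carrier G)" if P: "?P l" for l
  proof -
    from P obtain \<Phi> where "\<Phi> \<in> epi G (cyclic_power p l)" ..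
    then have "\<Phi> ` carrier G = {..<l} \<rightarrow>\<^sub>E {0..<int p}"
      using p0 by (simp add: epi_def carrier_cyclic_power)
    then have "card ({..<l} \<rightarrow>\<^sub>E {0..<int p}) \<le> card (carrier G)"
      using fin by (metis card_image_le)
    then have "p ^ l \<le> card (carrier G)" by (simp add: card_PiE)
    moreover have "l < p ^ l" using p1 by (intro power_gt_expt) simp
    ultimately show ?thesis by simp
  qed
  obtain l where l: "?P l" and maximal: "\<And>m. ?P m \<Longrightarrow> m \<le> l"
    using GreatestI_nat[of ?P 0 "card (carrier G)"] Greatest_le_nat[of ?P _ "card (carrier G)"]
      base bound by blast
  then obtain \<Phi> where \<Phi>: "\<Phi> \<in> epi G (cyclic_power p l)" by blast
  then have hom: "\<Phi> \<in> hom G (cyclic_power p l)"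
    and surj: "\<Phi> ` carrier G = {..<l} \<rightarrow>\<^sub>E {0..<int p}"
    using p0 by (simp_all add: epi_def carrier_cyclic_power)
  have kernel: "x = \<one>" if x: "x \<in> carrier G" "\<Phi> x = \<one>\<^bsub>cyclic_power p l\<^esub>" for x
  proof (rule ccontr)
    assume "x \<noteq> \<one>"
    moreover have "ord x dvd p" using expo[OF x(1)] x(1) by (simp add: pow_eq_id)
    ultimately have "ord x = p"
      using p ord_eq_1[OF x(1)] by (meson prime_nat_iff)
    moreover obtain f where f: "additive_mod G (carrier G) (int p) f"
      "[f x = int (p div ord x)] (mod int p)"
      using additive_mod_of_order_exists[OF fin p0 expo x(1)] by blast
    ultimately have fx: "[f x = 1] (mod int p)" using p0 by simp
    let ?\<Psi> = "\<lambda>m. (\<Phi> m)(l := f m mod int p)"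
    have mem: "\<Phi> m \<in> {..<l} \<rightarrow>\<^sub>E {0..<int p}" if "m \<in> carrier G" for m
      using surj that by blast
    have mem': "?\<Psi> m \<in> {..<Suc l} \<rightarrow>\<^sub>E {0..<int p}" if "m \<in> carrier G" for m
      using mem[OF that] p0 by (simp add: PiE_iff extensional_def less_Suc_eq Ball_def)
    have "?\<Psi> \<in> hom G (cyclic_power p (Suc l))"
    proof (rule homI)
      fix m assume "m \<in> carrier G"
      then show "?\<Psi> m \<in> carrier (cyclic_power p (Suc l))"
        using mem' p0 by (simp add: carrier_cyclic_power)
    next
      fix m m' assume m: "m \<in> carrier G" "m' \<in> carrier G"
      have "f (m \<otimes> m') mod int p = (f m mod int p + f m' mod int p) mod int p"
        using additive_modD[OF f(1) m] by (simp add: cong_def mod_add_eq)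
      moreover have "\<Phi> (m \<otimes> m') = (\<lambda>i\<in>{..<l}. (\<Phi> m i + \<Phi> m' i) mod int p)"
        using hom_mult[OF hom m] by (simp add: mult_cyclic_power)
      ultimately show "?\<Psi> (m \<otimes> m') = ?\<Psi> m \<otimes>\<^bsub>cyclic_power p (Suc l)\<^esub> ?\<Psi> m'"
        by (auto simp: mult_cyclic_power fun_eq_iff)
    qed
    moreover have "w \<in> ?\<Psi> ` carrier G" if w: "w \<in> {..<Suc l} \<rightarrow>\<^sub>E {0..<int p}" for w
    proof -
      have "restrict w {..<l} \<in> {..<l} \<rightarrow>\<^sub>E {0..<int p}"
        using w by (simp add: PiE_iff Ball_def)
      then have "restrict w {..<l} \<in> \<Phi> ` carrier G" by (simp only: surj)
      then obtain m where m: "m \<in> carrier G" "\<Phi> m = restrict w {..<l}" by force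
      \<comment> \<open>multiplying \<open>m\<close> by \<open>x\<^sup>k\<close> corrects the last coordinate, as \<open>f x = 1\<close>\<close>
      define k where "k = w l - f m"
      have xk: "x [^] k \<in> carrier G" using x by simp
      have grp: "group (cyclic_power p l)" by (rule group_cyclic_power)
      have "\<Phi> (x [^] k) = \<one>\<^bsub>cyclic_power p l\<^esub>"
        using hom_int_pow[OF hom x(1) is_group grp, of k] x(2) group.int_pow_one[OF grp] by simp
      then have \<Phi>m: "\<Phi> (m \<otimes> x [^] k) = restrict w {..<l}"
        using hom_mult[OF hom m(1) xk] hom_in_carrier[OF hom m(1)] group.is_monoid[OF grp] m(2)
        by (simp add: monoid.r_one)
      have "[f (m \<otimes> x [^] k) = f m + f (x [^] k)] (mod int p)"
        by (rule additive_modD[OF f(1) m(1) xk])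
      also have "[f m + f (x [^] k) = f m + k * f x] (mod int p)"
        using additive_mod_int_pow[OF subgroup_self f(1) x(1)] by (simp add: cong_add_lcancel)
      also have "[f m + k * f x = f m + k * 1] (mod int p)"
        using fx by (intro cong_add cong_mult) auto
      also have "f m + k * 1 = w l" by (simp add: k_def)
      finally have "f (m \<otimes> x [^] k) mod int p = w l"
        using PiE_mem[OF w, of l] by (simp add: cong_def)
      with \<Phi>m have "?\<Psi> (m \<otimes> x [^] k) = w"
        using PiE_arb[OF w] by (auto simp: fun_eq_iff less_Suc_eq)
      then have "w = ?\<Psi> (m \<otimes> x [^] k)" by (rule sym)
      then show ?thesis by (rule image_eqI) (use m(1) xk in simp)
    qed
    moreover from mem' have "?\<Psi> ` carrier G \<subseteq> {..<Suc l} \<rightarrow>\<^sub>E {0..<int p}" by (rule image_subsetI)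
    ultimately have "?\<Psi> \<in> epi G (cyclic_power p (Suc l))"
      unfolding epi_def carrier_cyclic_power[OF p0] by blast
    then have "Suc l \<le> l" using maximal by blast
    then show False by simp
  qed
  have "\<Phi> \<in> iso G (cyclic_power p l)"
    unfolding iso_iff_mon_epi mon_iff_hom_one[OF is_group group_cyclic_power]
    using hom \<Phi> kernel by blast
  then show ?thesis by (auto intro: is_isoI)
qed

text \<open>An element of order 2 and one of order 3 would have a product of order 6.\<close>
lemma (in comm_group) exponent_2_or_3_if_orders_le_3:
  assumes ord: "\<And>x. x \<in> carrier G \<Longrightarrow> ord x \<noteq> 0 \<and> ord x \<le> 3"
  shows "(\<forall>x\<in>carrier G. x [^] (2::nat) = \<one>) \<or> (\<forall>x\<in>carrier G. x [^] (3::nat) = \<one>)"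
proof (rule ccontr)
  assume "\<not> ?thesis"
  then obtain x y where xy: "x \<in> carrier G" "y \<in> carrier G"
    and "x [^] (3::nat) \<noteq> \<one>" "y [^] (2::nat) \<noteq> \<one>" by blast
  then have nx: "\<not> ord x dvd 3" and ny: "\<not> ord y dvd 2" by (simp_all add: pow_eq_id)
  have cases: "n = 1 \<or> n = 2 \<or> n = 3" if "n \<noteq> 0 \<and> n \<le> 3" for n :: nat using that by arith
  have ox: "ord x = 2" using cases[OF ord[OF xy(1)]] nx by auto
  have oy: "ord y = 3" using cases[OF ord[OF xy(2)]] ny by auto
  have x2: "x [^] (2::nat) = \<one>" and y3: "y [^] (3::nat) = \<one>"
    using xy ox oy by (simp_all add: pow_eq_id)
  have x3: "x [^] (3::nat) \<noteq> \<one>" and y2: "y [^] (2::nat) \<noteq> \<one>"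
    using xy nx ny by (simp_all add: pow_eq_id)
  have "(x \<otimes> y) [^] (2::nat) = y [^] (2::nat)"
    using xy x2 by (simp add: pow_mult_distrib m_comm)
  then have n2: "\<not> ord (x \<otimes> y) dvd 2" using y2 xy by (simp flip: pow_eq_id)
  have "(x \<otimes> y) [^] (3::nat) = x [^] (3::nat)"
    using xy y3 by (simp add: pow_mult_distrib m_comm)
  then have n3: "\<not> ord (x \<otimes> y) dvd 3" using x3 xy by (simp flip: pow_eq_id)
  from cases[OF ord[of "x \<otimes> y"]] xy n2 n3 show False by auto
qed

section \<open>The groups \<open>M_group r \<alpha> N\<close> and their surjections from a finite abelian group\<close>

lemma comm_group_int_sq: "comm_group int_sq_group"
  by (intro group.group_comm_groupI DirProd_group) (auto simp: add.commute)

lemma nat_pow_int_sq: "(u, v) [^]\<^bsub>int_sq_group\<^esub> (k::nat) = (int k * u, int k * v)"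
  by (induction k) (auto simp: algebra_simps)

lemma int_pow_int_sq: "(u, v) [^]\<^bsub>int_sq_group\<^esub> (k::int) = (k * u, k * v)"
  by (auto simp: int_pow_def2 nat_pow_int_sq inv_DirProd)

abbreviation relation_lattice :: "int \<Rightarrow> int \<Rightarrow> int \<Rightarrow> (int \<times> int) set" where
  "relation_lattice r \<alpha> N \<equiv> generate int_sq_group {(r, - \<alpha>), (0, N)}"

lemma subgroup_relation_lattice: "subgroup (relation_lattice r \<alpha> N) int_sq_group"
  by (rule group.generate_is_subgroup) (simp_all add: comm_group.axioms comm_group_int_sq)

lemma mem_relation_lattice_iff:
  "(u, v) \<in> relation_lattice r \<alpha> N \<longleftrightarrow> (\<exists>i j. u = i * r \<and> v = j * N - i * \<alpha>)"
proof
  have "\<exists>i j. w = (i * r, j * N - i * \<alpha>)" if "w \<in> relation_lattice r \<alpha> N" for w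
    using that
  proof induction
    case one
    show ?case by (intro exI[of _ 0]) simp
  next
    case (incl h)
    then consider "h = (r, - \<alpha>)" | "h = (0, N)" by blast
    then show ?case
    proof cases
      case 1 then show ?thesis by (intro exI[of _ 1] exI[of _ 0]) simp
    next
      case 2 then show ?thesis by (intro exI[of _ 0] exI[of _ 1]) simp
    qed
  next
    case (inv h)
    then consider "h = (r, - \<alpha>)" | "h = (0, N)" by blast
    then show ?case
    proof cases
      case 1 then show ?thesis by (intro exI[of _ "-1"] exI[of _ 0]) simp
    next
      case 2 then show ?thesis by (intro exI[of _ 0] exI[of _ "-1"]) simp
    qed
  next
    case (eng h1 h2)
    then obtain i j i' j' where "h1 = (i * r, j * N - i * \<alpha>)" "h2 = (i' * r, j' * N - i' * \<alpha>)"
      by blast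
    then show ?case by (intro exI[of _ "i + i'"] exI[of _ "j + j'"]) (simp add: algebra_simps)
  qed
  then show "\<exists>i j. u = i * r \<and> v = j * N - i * \<alpha>" if "(u, v) \<in> relation_lattice r \<alpha> N"
    using that by blast
next
  assume "\<exists>i j. u = i * r \<and> v = j * N - i * \<alpha>"
  then obtain i j where ij: "u = i * r" "v = j * N - i * \<alpha>" by blast
  have pow: "x [^]\<^bsub>int_sq_group\<^esub> k \<in> relation_lattice r \<alpha> N"
    if "x \<in> {(r, - \<alpha>), (0, N)}" for x and k :: int
    by (rule group.subgroup_int_pow_closed[OF _ subgroup_relation_lattice generate.incl[OF that]])
      (simp add: comm_group.axioms comm_group_int_sq)
  have "(r, - \<alpha>) [^]\<^bsub>int_sq_group\<^esub> i \<otimes>\<^bsub>int_sq_group\<^esub> (0, N) [^]\<^bsub>int_sq_group\<^esub> j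
      \<in> relation_lattice r \<alpha> N"
    by (intro generate.eng pow) auto
  then show "(u, v) \<in> relation_lattice r \<alpha> N" by (simp add: int_pow_int_sq ij)
qed

definition lattice_class :: "int \<Rightarrow> int \<Rightarrow> int \<Rightarrow> int \<times> int \<Rightarrow> (int \<times> int) set" where
  "lattice_class r \<alpha> N v = relation_lattice r \<alpha> N #>\<^bsub>int_sq_group\<^esub> v"

lemma normal_relation_lattice: "relation_lattice r \<alpha> N \<lhd> int_sq_group"
  by (rule comm_group.subgroup_imp_normal[OF comm_group_int_sq subgroup_relation_lattice])

lemma group_M_group: "group (M_group r \<alpha> N)"
  unfolding M_group_def by (rule normal.factorgroup_is_group[OF normal_relation_lattice])

lemma carrier_M_group: "carrier (M_group r \<alpha> N) = range (lattice_class r \<alpha> N)"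
  by (simp add: M_group_def carrier_FactGroup lattice_class_def [abs_def])

lemma mult_M_group:
  "lattice_class r \<alpha> N (u, v) \<otimes>\<^bsub>M_group r \<alpha> N\<^esub> lattice_class r \<alpha> N (u', v')
    = lattice_class r \<alpha> N (u + u', v + v')"
  using normal.rcos_sum[OF normal_relation_lattice, of "(u, v)" "(u', v')" r \<alpha> N]
  by (simp add: M_group_def lattice_class_def)

lemma pow_M_group:
  "lattice_class r \<alpha> N (u, v) [^]\<^bsub>M_group r \<alpha> N\<^esub> (k::nat) = lattice_class r \<alpha> N (int k * u, int k * v)"
  using normal.FactGroup_pow[OF normal_relation_lattice, of "(u, v)" r \<alpha> N k]
  by (simp add: M_group_def lattice_class_def nat_pow_int_sq)

lemma lattice_class_eqI:
  assumes "(u' - u, v' - v) \<in> relation_lattice r \<alpha> N"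
  shows "lattice_class r \<alpha> N (u, v) = lattice_class r \<alpha> N (u', v')"
  unfolding lattice_class_def
proof (rule group.repr_independence[OF _ _ _ subgroup_relation_lattice])
  have "(u', v') = (u' - u, v' - v) \<otimes>\<^bsub>int_sq_group\<^esub> (u, v)" by simp
  then show "(u', v') \<in> relation_lattice r \<alpha> N #>\<^bsub>int_sq_group\<^esub> (u, v)"
    unfolding r_coset_def using assms by blast
qed (simp_all add: comm_group.axioms comm_group_int_sq)

lemma lattice_class_eq_one_iff:
  "lattice_class r \<alpha> N w = \<one>\<^bsub>M_group r \<alpha> N\<^esub> \<longleftrightarrow> w \<in> relation_lattice r \<alpha> N"
proof -
  have grp: "group int_sq_group" by (simp add: comm_group.axioms comm_group_int_sq)
  show ?thesis
    using group.coset_join1[OF grp _ _ subgroup_relation_lattice, of r \<alpha> N w]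
      group.coset_join2[OF grp _ subgroup_relation_lattice, of w r \<alpha> N]
    by (auto simp: M_group_def lattice_class_def)
qed

lemma d_val_eqI:
  assumes "N > 0" "0 < d" "d \<le> N" "[d = - q * \<alpha>] (mod N)"
  shows "d_val \<alpha> N q = d"
  unfolding d_val_def using the1_equality[OF d_val_unique[OF assms(1)]] assms(2-4) by blast

lemma two_mem_Omega_set:
  assumes "N \<ge> 2"
  shows "2 \<in> Omega_set (N - 1) N"
proof -
  have d: "d_val (N - 1) N q = q" if "0 < q" "q \<le> N" for q
    using that assms by (intro d_val_eqI) (auto simp: cong_iff_dvd_diff algebra_simps)
  have "gcd (N - 1) N = 1" 
    using gcd_add1[of 1 "N - 1"] by simp
  then show ?thesis using assms d by (auto simp: Omega_set_def)
qed

text \<open>The group \<open>M_group 1 (N - 1) N\<close> is cyclic of order \<open>N\<close>, generated by the class of \<open>(0, 1)\<close>.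
  For this choice of parameters \<open>d_val\<close> is the identity on \<open>{1..N}\<close>, so every index there is a
  record. The index \<open>2\<close> is admissible: \<open>2 < N\<close>, and \<open>2 (N - 1) \<equiv> -2\<close> is \<open>1\<close> modulo \<open>N\<close>
  only if \<open>N\<close> divides \<open>3\<close>.\<close>
lemma Sigma_set_nonempty_if_large_cyclic_quotient:
  fixes G (structure)
  assumes G: "group G" and N: "N \<ge> 4" and f: "additive_mod G (carrier G) N f"
    and surj: "\<And>k. \<exists>x\<in>carrier G. [f x = k] (mod N)"
  shows "Sigma_set G \<noteq> {}"
proof -
  interpret group G by (rule G)
  define \<phi> where "\<phi> = (\<lambda>x\<in>carrier G. lattice_class 1 (N - 1) N (0, f x))"
  have cls: "lattice_class 1 (N - 1) N (0, u) = lattice_class 1 (N - 1) N (a, b)"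
    if "[u = b + a * (N - 1)] (mod N)" for a b u
  proof (rule lattice_class_eqI)
    from that have "N dvd u - (b + a * (N - 1))" by (simp add: cong_iff_dvd_diff)
    then obtain c where c: "u - (b + a * (N - 1)) = N * c" ..
    have "a - 0 = a * 1 \<and> b - u = - c * N - a * (N - 1)"
      using c by (simp add: algebra_simps)
    then show "(a - 0, b - u) \<in> relation_lattice 1 (N - 1) N"
      unfolding mem_relation_lattice_iff by blast
  qed
  have hom: "\<phi> \<in> hom G (M_group 1 (N - 1) N)"
  proof (rule homI)
    fix x y assume xy: "x \<in> carrier G" "y \<in> carrier G"
    have "\<phi> (x \<otimes> y) = lattice_class 1 (N - 1) N (0, f (x \<otimes> y))" using xy by (simp add: \<phi>_def)
    also have "\<dots> = lattice_class 1 (N - 1) N (0 + 0, f x + f y)"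
      using additive_modD[OF f xy] by (intro cls) simp
    also have "\<dots> = \<phi> x \<otimes>\<^bsub>M_group 1 (N - 1) N\<^esub> \<phi> y"
      using xy by (simp only: \<phi>_def restrict_apply' mult_M_group)
    finally show "\<phi> (x \<otimes> y) = \<phi> x \<otimes>\<^bsub>M_group 1 (N - 1) N\<^esub> \<phi> y" .
  qed (simp add: \<phi>_def carrier_M_group)
  have onto: "w \<in> \<phi> ` carrier G" if "w \<in> carrier (M_group 1 (N - 1) N)" for w
  proof -
    from that obtain a b where w: "w = lattice_class 1 (N - 1) N (a, b)"
      unfolding carrier_M_group by auto
    obtain x where x: "x \<in> carrier G" "[f x = b + a * (N - 1)] (mod N)" using surj by blast
    have "\<phi> x = w" unfolding w using cls[OF x(2)] x(1) by (simp add: \<phi>_def)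
    then show ?thesis using x(1) by blast
  qed
  have "\<phi> ` carrier G = carrier (M_group 1 (N - 1) N)"
    using hom_in_carrier[OF hom] onto by blast
  then have "\<phi> \<in> epi G (M_group 1 (N - 1) N) \<inter> extensional (carrier G)"
    using hom by (simp add: epi_def \<phi>_def)
  moreover have "gcd (N - 1) N = 1"
    using gcd_add1[of 1 "N - 1"] by simp
  moreover have "\<not> [2 * (N - 1) = 1] (mod N)"
  proof
    assume "[2 * (N - 1) = 1] (mod N)"
    then have "N dvd 2 * N - 3" by (simp add: cong_iff_dvd_diff algebra_simps)
    then have "N dvd 3" by (simp add: dvd_diff_right_iff)
    then show False using N zdvd_imp_le[of N 3] by simp
  qed
  ultimately have "(1, N - 1, N, 2, \<phi>) \<in> Sigma_set G"
    using N two_mem_Omega_set[of N] by (simp add: Sigma_set_def)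
  then show ?thesis by blast
qed

text \<open>If \<open>p\<close> kills the quotient, the vectors \<open>(0, p)\<close> and \<open>(p, 0)\<close> are relations. The first
  forces \<open>N\<close> to divide \<open>p\<close>, the second forces \<open>r\<close> to divide \<open>p\<close>. If \<open>r = p\<close>, then
  \<open>(p, 0)\<close> differs from the relation \<open>(r, - \<alpha>)\<close> by a multiple of \<open>(0, N)\<close>, so \<open>N\<close> divides
  \<open>\<alpha> < N\<close>.\<close>
lemma pow_prime_eq_one_imp_M_group_params:
  assumes p: "prime p" and "r > 0" "N > 1" "0 \<le> \<alpha>" "\<alpha> < N"
    and kill: "\<And>w. w \<in> carrier (M_group r \<alpha> N) \<Longrightarrow> w [^]\<^bsub>M_group r \<alpha> N\<^esub> p = \<one>\<^bsub>M_group r \<alpha> N\<^esub>"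
  shows "N = int p" "r = 1 \<or> \<alpha> = 0"
proof -
  have mem: "(int p * u, int p * v) \<in> relation_lattice r \<alpha> N" for u v
    using kill[of "lattice_class r \<alpha> N (u, v)"]
    by (simp add: carrier_M_group pow_M_group lattice_class_eq_one_iff)
  have prime: "prime (int p)" using p by simp
  from mem[of 0 1] obtain i j where "0 = i * r" "int p = j * N - i * \<alpha>"
    by (auto simp: mem_relation_lattice_iff)
  then have "N dvd int p" using \<open>r > 0\<close> by simp
  have prime_divisor: "m = 1 \<or> m = int p" if "m dvd int p" "m > 0" for m
    using prime that unfolding prime_int_iff by (meson order_less_imp_le)
  from prime_divisor[OF \<open>N dvd int p\<close>] \<open>N > 1\<close> show N: "N = int p" by simp
  from mem[of 1 0] obtain i j where ij: "int p = i * r" "j * N = i * \<alpha>"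
    by (auto simp: mem_relation_lattice_iff)
  then have "r dvd int p" by simp
  then consider "r = 1" | "r = int p" using prime_divisor \<open>r > 0\<close> by blast
  then show "r = 1 \<or> \<alpha> = 0"
  proof cases
    case 2
    then have "i = 1" using ij(1) prime by auto
    then have "\<alpha> = j * N" using ij(2) by simp
    then have "N dvd \<alpha>" by simp
    then show ?thesis using \<open>0 \<le> \<alpha>\<close> \<open>\<alpha> < N\<close> zdvd_not_zless[of \<alpha> N] by auto
  qed simp
qed

text \<open>Only \<open>r = 1\<close>, \<open>N = 3\<close>, \<open>\<alpha> = 2\<close> passes the bounds on the parameters: \<open>\<alpha> = 0\<close> leaves
  no index below \<open>N / gcd \<alpha> N = 1\<close>, and \<open>r = 1\<close> requires \<open>1 < \<alpha> < N \<le> 3\<close>. There \<open>q = 1\<close>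
  is excluded by \<open>q r \<noteq> 1\<close> and \<open>q = 2\<close> because \<open>2 \<cdot> 2 \<equiv> 1\<close> modulo \<open>3\<close>.\<close>
lemma Sigma_set_empty_if_exponent_2_or_3:
  fixes G (structure)
  assumes G: "group G" and p: "p = 2 \<or> p = (3::nat)"
    and expo: "\<And>x. x \<in> carrier G \<Longrightarrow> x [^] p = \<one>"
  shows "Sigma_set G = {}"
proof (rule ccontr)
  interpret group G by (rule G)
  assume "Sigma_set G \<noteq> {}"
  then obtain s where "s \<in> Sigma_set G" by blast
  moreover obtain r \<alpha> N q \<phi> where "s = (r, \<alpha>, N, q, \<phi>)" by (cases s)
  ultimately have \<alpha>: "0 \<le> \<alpha>" "\<alpha> < N" and r: "r > 0" and N: "N > 1"
    and large: "r > 1 \<or> \<alpha> > 1" and q: "q \<in> Omega_set \<alpha> N" "q * r \<noteq> 1"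
      "\<not> [q * \<alpha> = 1] (mod N)" "q \<noteq> N div gcd \<alpha> N"
    and \<phi>: "\<phi> \<in> epi G (M_group r \<alpha> N)"
    unfolding Sigma_set_def by simp_all
  have qN: "0 < q" "q < N div gcd \<alpha> N" using q(1,4) by (auto simp: Omega_set_def)
  have "prime p" using p by auto
  moreover have "w [^]\<^bsub>M_group r \<alpha> N\<^esub> p = \<one>\<^bsub>M_group r \<alpha> N\<^esub>"
    if "w \<in> carrier (M_group r \<alpha> N)" for w
  proof -
    from \<phi> have hom: "\<phi> \<in> hom G (M_group r \<alpha> N)" and "\<phi> ` carrier G = carrier (M_group r \<alpha> N)"
      by (simp_all add: epi_def)
    with that obtain x where "x \<in> carrier G" "w = \<phi> x" by blast
    then show ?thesis
      using hom_nat_pow[OF hom _ G group_M_group] expo hom_one[OF hom G group_M_group] by metis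
  qed
  ultimately have params: "N = int p" "r = 1 \<or> \<alpha> = 0"
    using pow_prime_eq_one_imp_M_group_params[OF _ r N \<alpha>] by blast+
  have "\<alpha> \<noteq> 0" using qN N by auto
  then have "r = 1" "\<alpha> > 1" using params(2) large by auto
  then have "N = 3" "\<alpha> = 2" using params(1) p \<alpha> by auto
  then have "q = 1 \<or> q = 2" using qN by auto
  then show False using q(2,3) \<open>r = 1\<close> \<open>N = 3\<close> \<open>\<alpha> = 2\<close> by (auto simp: cong_def)
qed

lemma exponent_if_iso_cyclic_power:
  fixes G (structure)
  assumes G: "group G" and "n > 0" and iso: "G \<cong> cyclic_power n l" and x: "x \<in> carrier G"
  shows "x [^] n = \<one>"
proof -
  obtain h where h: "h \<in> iso G (cyclic_power n l)" using iso by (auto simp: is_iso_def)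
  then have hom: "h \<in> hom G (cyclic_power n l)" and inj: "inj_on h (carrier G)"
    by (auto simp: iso_def bij_betw_def)
  have "h (x [^] n) = h \<one>"
    using hom_nat_pow[OF hom x G group_cyclic_power] hom_one[OF hom G group_cyclic_power]
      pow_cyclic_power_eq_one[OF \<open>n > 0\<close>] by simp
  then show ?thesis
    using inj x G by (simp add: inj_on_eq_iff group.is_monoid monoid.nat_pow_closed monoid.one_closed)
qed

theorem proposition4p43:
  fixes M :: "('a, 'b) monoid_scheme"
  assumes "comm_group M" and "finite (carrier M)"
  shows "Sigma_set M = {} \<longleftrightarrow>
    (\<exists>l. M \<cong> cyclic_power 2 l) \<or> (\<exists>l. M \<cong> cyclic_power 3 l)"
proof
  interpret comm_group M by (rule assms(1))
  assume empty: "Sigma_set M = {}"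
  have "group.ord M x \<noteq> 0 \<and> group.ord M x \<le> 3" if x: "x \<in> carrier M" for x
  proof -
    obtain N f where N: "N > 0" "int (group.ord M x) dvd N"
      and f: "additive_mod M (carrier M) N f" "\<And>k. \<exists>y\<in>carrier M. [f y = k] (mod N)"
      using cyclic_quotient_of_order_multiple[OF assms(2) x] by blast
    have "\<not> N \<ge> 4"
      using Sigma_set_nonempty_if_large_cyclic_quotient[OF is_group _ f] empty by blast
    moreover have "int (group.ord M x) \<le> N" using N by (simp add: zdvd_imp_le)
    moreover have "group.ord M x \<noteq> 0" using N by (cases "group.ord M x = 0") simp_all
    ultimately show ?thesis by linarith
  qed
  then have "(\<forall>x\<in>carrier M. x [^]\<^bsub>M\<^esub> (2::nat) = \<one>\<^bsub>M\<^esub>) \<or> (\<forall>x\<in>carrier M. x [^]\<^bsub>M\<^esub> (3::nat) = \<one>\<^bsub>M\<^esub>)"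
    by (rule exponent_2_or_3_if_orders_le_3)
  moreover have "prime (2::nat)" "prime (3::nat)" by simp_all
  ultimately show "(\<exists>l. M \<cong> cyclic_power 2 l) \<or> (\<exists>l. M \<cong> cyclic_power 3 l)"
    using iso_cyclic_power_if_prime_exponent[OF assms(2)] by blast
next
  interpret comm_group M by (rule assms(1))
  assume "(\<exists>l. M \<cong> cyclic_power 2 l) \<or> (\<exists>l. M \<cong> cyclic_power 3 l)"
  then obtain p l where p: "p = 2 \<or> p = (3::nat)" and "M \<cong> cyclic_power p l" by blast
  then have "x [^]\<^bsub>M\<^esub> p = \<one>\<^bsub>M\<^esub>" if "x \<in> carrier M" for x
    using exponent_if_iso_cyclic_power[OF is_group _ _ that] by auto
  then show "Sigma_set M = {}"
    by (rule Sigma_set_empty_if_exponent_2_or_3[OF is_group p])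
qed

end
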